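(* Let $G=(V,E)$ be a finite connected simple graph, let $\mu$ be a Bernoulli bond percolation measure on $\Omega=\{0,1\}^E$, and let $C_1,C_2$ be independent configurations each distributed as $\mu$. Let $S=S(C_1,C_2)$ be the set built by some decision tree. Let $A,B\subseteq\Omega$ be events closed upward. Then $$\mathbf{P}(C_1\in A,\ C_1\to_S C_2\in B)\ \ge\ \mathbf{P}(C_1\in A)\,\mathbf{P}(C_1\to_S C_2\in B)=\mu(A)\mu(B).$$
   Context: $\mu$ is the product measure on $\Omega=\{0,1\}^E$ in which edge $e$ is open (value 1) with probability $p_e\in[0,1]$; $\mathbf{P}$ is the law of the independent pair $(C_1,C_2)$. An event $A\subseteq\Omega$ is closed upward if $C\in A$ and $C\le C'$ coordinatewise imply $C'\in A$. For configurations $C_1,C_2$ and $S\subseteq E$, $C_1\to_S C_2$ is the configuration equal to $C_1(e)$ for $e\in S$ and to $C_2(e)$ for $e\in\overline S=E\setminus S$. Decision tree: a finite rooted tree (root $N_0$) whose nodes are decision nodes or leaf nodes. Each node $N$ carries an edge $e\in E$ that it queries and a decision in $\{\text{“}S\text{”},\text{“}\overline S\text{”}\}$; each decision node has four children indexed by $00,01,10,11$; the nodes on every path from the root query pairwise distinct edges. Given $(C_1,C_2)$, start at the root; at each visited node with edge $e$, put $e$ into $S$ if the decision is “$S$” and into $\overline S$ otherwise, reveal $C_1(e)$ and $C_2(e)$, and (at a decision node) move to the child indexed by $C_1(e)C_2(e)$; stop after processing a leaf node. Edges never queried belong to $\overline S$. The resulting set $S(C_1,C_2)\subseteq E$ is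 the set built by the tree. *)

theory Defs
  imports "HOL-Probability.Probability" "HOL-Probability.Product_PMF" "HOL-Library.Ramsey"
begin

text \<open>Edges are two-element subsets of the vertex set.\<close>

definition finite_simple_graph :: "'v set \<Rightarrow> 'v set set \<Rightarrow> bool" where
  "finite_simple_graph V E \<longleftrightarrow> finite V \<and> E \<subseteq> nsets V 2"

definition connected_graph :: "'v set \<Rightarrow> 'v set set \<Rightarrow> bool" where
  "connected_graph V E \<longleftrightarrow> V \<noteq> {} \<and> (\<forall>u\<in>V. \<forall>v\<in>V. (u, v) \<in> {(x, y). {x, y} \<in> E}\<^sup>*)"

text \<open>A configuration is an extensional function on \<open>E\<close>: it is \<open>undefined\<close> outside \<open>E\<close>,
  so that \<open>configs E\<close> is in bijection with \<open>{0,1}\<^sup>E\<close>. \<open>True\<close> stands for 1 (open).\<close>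

definition configs :: "'e set \<Rightarrow> ('e \<Rightarrow> bool) set" where
  "configs E = (E \<rightarrow>\<^sub>E UNIV)"

definition percolation :: "'e set \<Rightarrow> ('e \<Rightarrow> real) \<Rightarrow> ('e \<Rightarrow> bool) pmf" where
  "percolation E p = Pi_pmf E undefined (\<lambda>e. bernoulli_pmf (p e))"

definition closed_upward :: "'e set \<Rightarrow> ('e \<Rightarrow> bool) set \<Rightarrow> bool" where
  "closed_upward E A \<longleftrightarrow>
     (\<forall>C\<in>A. \<forall>C'\<in>configs E. (\<forall>e\<in>E. C e \<le> C' e) \<longrightarrow> C' \<in> A)"

text \<open>\<open>switch_config C1 S C2\<close> is the configuration written \<open>C\<^sub>1 \<rightarrow>\<^sub>S C\<^sub>2\<close>.\<close>

definition switch_config :: "('e \<Rightarrow> bool) \<Rightarrow> 'e set \<Rightarrow> ('e \<Rightarrow> bool) \<Rightarrow> 'e \<Rightarrow> bool" where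
  "switch_config C1 S C2 = (\<lambda>e. if e \<in> S then C1 e else C2 e)"

datatype decision = Into_S | Into_complement

text \<open>Leaves query an edge as well. The children of a decision node are indexed by the
  revealed values of \<open>C\<^sub>1\<close> and \<open>C\<^sub>2\<close>, in this order.\<close>

datatype 'e query_tree =
    Leaf 'e decision
  | Node 'e decision "bool \<Rightarrow> bool \<Rightarrow> 'e query_tree"

text \<open>The sequences of edges queried along the paths from the root to a leaf.\<close>

primrec branches :: "'e query_tree \<Rightarrow> 'e list set" where
  "branches (Leaf e d) = {[e]}"
| "branches (Node e d child) = (\<Union>i j. (#) e ` branches (child i j))"

definition decision_tree :: "'e set \<Rightarrow> 'e query_tree \<Rightarrow> bool" where
  "decision_tree E T \<longleftrightarrow> (\<forall>es\<in>branches T. set es \<subseteq> E \<and> distinct es)"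

fun decide :: "'e \<Rightarrow> decision \<Rightarrow> 'e set" where
  "decide e Into_S = {e}"
| "decide e Into_complement = {}"

primrec built_set :: "'e query_tree \<Rightarrow> ('e \<Rightarrow> bool) \<Rightarrow> ('e \<Rightarrow> bool) \<Rightarrow> 'e set" where
  "built_set (Leaf e d) C1 C2 = decide e d"
| "built_set (Node e d child) C1 C2 =
     decide e d \<union> built_set (child (C1 e) (C2 e)) C1 C2"

end

theory Submission
  imports Defs
begin

text \<open>
  The inequality is the Harris inequality for an increasing event of \<open>C1\<close> and an increasing event
  of the mixture \<open>C1 \<rightarrow>\<^sub>S C2\<close>, and it is proved by induction on the tree, one query at a time.

  Condition on the values \<open>i\<close> and \<open>j\<close> that the root query reveals at its edge \<open>e\<close>. What remains is a
  pair of independent configurations on \<open>E - {e}\<close>, explored by the child tree for \<open>i\<close> and \<open>j\<close>, with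
  \<open>A\<close> replaced by its section at \<open>i\<close>, and \<open>B\<close> by its section at \<open>i\<close> if \<open>e\<close> is put into \<open>S\<close> and
  at \<open>j\<close> otherwise. By induction the conditional probability is at least the product
  \<open>a i * b i\<close> or \<open>a i * b j\<close> of the measures of the two sections. Averaging over \<open>i\<close> and \<open>j\<close>, the
  second case gives exactly the product of the means, by independence, and the first gives at least
  that, by Chebyshev's sum inequality, because \<open>a\<close> and \<open>b\<close> are both increasing.
  The children may differ arbitrarily with \<open>i\<close> and \<open>j\<close>, because the bound for each child mentions
  only the sections and not the rule that the child follows.

  The induction is carried out for increasing real functions \<open>f\<close>, \<open>g\<close> instead of indicators of
  events. This also yields that the mixture has law \<open>\<mu>\<close> as far as increasing events can tell: the
  choices \<open>f = 1\<close> and \<open>f = -1\<close> turn the inequality into two opposite bounds for the mean of \<open>g\<close>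
  of the mixture. The induction step is \<open>harris_query\<close>, the induction itself \<open>harris_tree\<close>, and the
  law of the mixture \<open>mean_switch\<close>.
\<close>

section \<open>Means over percolation configurations\<close>

abbreviation mean :: "'e set \<Rightarrow> ('e \<Rightarrow> real) \<Rightarrow> (('e \<Rightarrow> bool) \<Rightarrow> real) \<Rightarrow> real" where
  "mean F p \<equiv> measure_pmf.expectation (percolation F p)"

lemma set_percolation: "finite F \<Longrightarrow> set_pmf (percolation F p) \<subseteq> configs F"
  unfolding percolation_def configs_def
  using set_Pi_pmf_subset[of F undefined "\<lambda>e. bernoulli_pmf (p e)"]
  by (fastforce simp: PiE_def extensional_def)

lemma finite_percolation: "finite F \<Longrightarrow> finite (set_pmf (percolation F p))"
  by (rule finite_subset[OF set_percolation]) (auto simp: configs_def intro: finite_PiE)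

lemma integrable_percolation:
  fixes f :: "_ \<Rightarrow> real"
  shows "finite F \<Longrightarrow> integrable (measure_pmf (percolation F p)) f"
  by (rule integrable_measure_pmf_finite) (rule finite_percolation)

lemma mean_mono:
  assumes "finite F" "\<And>C. C \<in> configs F \<Longrightarrow> f C \<le> g C"
  shows "mean F p f \<le> mean F p g"
  using assms set_percolation[OF assms(1), of p]
  by (intro integral_mono_AE integrable_percolation) (auto simp: AE_measure_pmf_iff)

lemma mean_query:
  assumes "finite F" "e \<in> F"
  shows "mean F p f
    = (\<Sum>i\<in>UNIV. pmf (bernoulli_pmf (p e)) i * mean (F - {e}) p (\<lambda>C. f (C(e := i))))"
proof -
  have "percolation F p = bernoulli_pmf (p e) \<bind>
      (\<lambda>i. map_pmf (\<lambda>C. C(e := i)) (percolation (F - {e}) p))"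
    using Pi_pmf_insert'[of "F - {e}" e undefined "\<lambda>e. bernoulli_pmf (p e)"] assms
    by (simp add: percolation_def insert_absorb map_pmf_def)
  then have "mean F p f = (\<Sum>i\<in>UNIV. pmf (bernoulli_pmf (p e)) i *\<^sub>R
      measure_pmf.expectation (map_pmf (\<lambda>C. C(e := i)) (percolation (F - {e}) p)) f)"
    using assms(1) by (simp only:) (rule pmf_expectation_bind, auto intro: finite_percolation)
  then show ?thesis by simp
qed

text \<open>Fubini's theorem in the form that a query needs: both copies are conditioned on their values at
  the same edge, which leaves two independent configurations on the remaining edges.\<close>

lemma mean_mean_query:
  assumes "finite F" "e \<in> F"
  shows "mean F p (\<lambda>C1. mean F p (h C1))
    = (\<Sum>i\<in>UNIV. \<Sum>j\<in>UNIV. pmf (bernoulli_pmf (p e)) i * pmf (bernoulli_pmf (p e)) j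
        * mean (F - {e}) p (\<lambda>C1. mean (F - {e}) p (\<lambda>C2. h (C1(e := i)) (C2(e := j)))))"
proof -
  let ?q = "pmf (bernoulli_pmf (p e))" and ?m = "mean (F - {e}) p"
  have "mean F p (\<lambda>C1. mean F p (h C1))
      = (\<Sum>i\<in>UNIV. ?q i * ?m (\<lambda>C1. mean F p (h (C1(e := i)))))"
    by (rule mean_query[OF assms])
  also have "\<dots> = (\<Sum>i\<in>UNIV. ?q i *
      ?m (\<lambda>C1. \<Sum>j\<in>UNIV. ?q j * ?m (\<lambda>C2. h (C1(e := i)) (C2(e := j)))))"
    unfolding mean_query[OF assms, of p "h _"] ..
  also have "\<dots> = (\<Sum>i\<in>UNIV. \<Sum>j\<in>UNIV.
      ?q i * ?q j * ?m (\<lambda>C1. ?m (\<lambda>C2. h (C1(e := i)) (C2(e := j)))))"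
    using assms(1)
    by (subst Bochner_Integration.integral_sum)
      (auto intro: integrable_percolation simp: sum_distrib_left mult.assoc)
  finally show ?thesis .
qed

lemma expectation_pair_percolation:
  assumes "finite F"
  shows "measure_pmf.expectation (pair_pmf (percolation F p) (percolation F p)) h
    = mean F p (\<lambda>C1. mean F p (\<lambda>C2. h (C1, C2)))"
proof -
  let ?M = "percolation F p"
  note fin = finite_percolation[OF assms, of p]
  have "measure_pmf.expectation (pair_pmf ?M ?M) h
      = (\<Sum>C1\<in>set_pmf ?M. pmf ?M C1 *\<^sub>R
          measure_pmf.expectation (map_pmf (Pair C1) ?M) h)"
    unfolding pair_pmf_def map_pmf_def[symmetric]
    by (rule pmf_expectation_bind) (auto simp: fin)
  also have "\<dots> = mean F p (\<lambda>C1. mean F p (\<lambda>C2. h (C1, C2)))"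
    by (subst integral_measure_pmf[OF fin]) auto
  finally show ?thesis .
qed

section \<open>Monotonicity and sections\<close>

text \<open>Chebyshev's sum inequality on a two-point space: the difference of the two sides is
  \<open>q True * q False * (a True - a False) * (b True - b False)\<close>. It is the only source of
  positive correlation in the argument.\<close>

lemma two_point_Chebyshev:
  fixes q a b :: "bool \<Rightarrow> real"
  assumes "\<And>i. 0 \<le> q i" "q True + q False = 1" "a False \<le> a True" "b False \<le> b True"
  shows "(\<Sum>i\<in>UNIV. q i * a i) * (\<Sum>i\<in>UNIV. q i * b i) \<le> (\<Sum>i\<in>UNIV. q i * (a i * b i))"
proof -
  have "0 \<le> q True * q False * ((a True - a False) * (b True - b False))"
    using assms by simp
  moreover have qF: "q False = 1 - q True" using assms(2) by simp
  ultimately show ?thesis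
    unfolding UNIV_bool by (simp add: qF algebra_simps)
qed

lemma mono_on_section:
  assumes "e \<in> F" "mono_on (configs F) f"
  shows "mono_on (configs (F - {e})) (\<lambda>C. f (C(e := i)))"
proof (rule mono_onI)
  fix C D :: "'a \<Rightarrow> bool"
  assume "C \<in> configs (F - {e})" "D \<in> configs (F - {e})" "C \<le> D"
  then show "f (C(e := i)) \<le> f (D(e := i))"
    using assms
    by (intro mono_onD[OF assms(2)]) (auto simp: configs_def le_fun_def PiE_def extensional_def)
qed

lemma mean_section_mono:
  assumes "finite F" "e \<in> F" "mono_on (configs F) f"
  shows "mean (F - {e}) p (\<lambda>C. f (C(e := False))) \<le> mean (F - {e}) p (\<lambda>C. f (C(e := True)))"
  using assms by (intro mean_mono mono_onD[OF assms(3)])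
    (auto simp: configs_def le_fun_def PiE_def extensional_def)

section \<open>Rules with the Harris inequality\<close>

text \<open>Locality is what makes the rest of a tree independent of an edge that has been queried already:
  the rest does not look at this edge again and does not reassign it.\<close>

definition local_rule :: "'e set \<Rightarrow> (('e \<Rightarrow> bool) \<Rightarrow> ('e \<Rightarrow> bool) \<Rightarrow> 'e set) \<Rightarrow> bool" where
  "local_rule F S \<longleftrightarrow> (\<forall>C1 C2. S C1 C2 \<subseteq> F) \<and>
     (\<forall>C1 C2 D1 D2. (\<forall>e\<in>F. C1 e = D1 e \<and> C2 e = D2 e) \<longrightarrow> S C1 C2 = S D1 D2)"

text \<open>The induction hypothesis for a rule on the edge set \<open>F\<close>. On \<open>configs F\<close> the pointwise order of
  functions compares the values on \<open>F\<close>, since all configurations are \<open>undefined\<close> elsewhere.\<close>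

definition harris_rule ::
  "'e set \<Rightarrow> ('e \<Rightarrow> real) \<Rightarrow> (('e \<Rightarrow> bool) \<Rightarrow> ('e \<Rightarrow> bool) \<Rightarrow> 'e set) \<Rightarrow> bool" where
  "harris_rule F p S \<longleftrightarrow> local_rule F S \<and>
     (\<forall>f g. mono_on (configs F) f \<longrightarrow> mono_on (configs F) g \<longrightarrow>
        mean F p f * mean F p g
        \<le> mean F p (\<lambda>C1. mean F p (\<lambda>C2. f C1 * g (switch_config C1 (S C1 C2) C2))))"

lemma harris_ruleD:
  assumes "harris_rule F p S" "mono_on (configs F) f" "mono_on (configs F) g"
  shows "mean F p f * mean F p g
    \<le> mean F p (\<lambda>C1. mean F p (\<lambda>C2. f C1 * g (switch_config C1 (S C1 C2) C2)))"
  using assms unfolding harris_rule_def by blast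

text \<open>Here the mixture is \<open>C2\<close>, so the inequality is the equality given by independence. This
  is the state after a leaf, when all edges that remain go to the complement of \<open>S\<close>.\<close>

lemma harris_empty: "harris_rule F p (\<lambda>_ _. {})"
  by (simp add: harris_rule_def local_rule_def switch_config_def)

lemma local_query:
  assumes "e \<in> F" "\<And>i j. local_rule (F - {e}) (R i j)"
  shows "local_rule F (\<lambda>C1 C2. decide e d \<union> R (C1 e) (C2 e) C1 C2)"
  unfolding local_rule_def
proof (intro conjI allI impI)
  fix C1 C2
  show "decide e d \<union> R (C1 e) (C2 e) C1 C2 \<subseteq> F"
    using assms(2)[of "C1 e" "C2 e"] assms(1) by (cases d) (auto simp: local_rule_def)
next
  fix C1 C2 D1 D2 :: "'a \<Rightarrow> bool"
  assume *: "\<forall>e\<in>F. C1 e = D1 e \<and> C2 e = D2 e"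
  then have "R (C1 e) (C2 e) C1 C2 = R (C1 e) (C2 e) D1 D2"
    using assms(2)[of "C1 e" "C2 e"] unfolding local_rule_def by blast
  then show "decide e d \<union> R (C1 e) (C2 e) C1 C2 = decide e d \<union> R (D1 e) (D2 e) D1 D2"
    using * assms(1) by simp
qed

text \<open>After the query, the mixture is that of the remaining rule, with the value at \<open>e\<close> taken from the
  first copy or the second one according to the decision.\<close>

lemma switch_query:
  assumes "local_rule (F - {e}) R"
  shows "switch_config (C1(e := i)) (decide e d \<union> R (C1(e := i)) (C2(e := j))) (C2(e := j))
    = (switch_config C1 (R C1 C2) C2)(e := (if d = Into_S then i else j))"
proof -
  have "R (C1(e := i)) (C2(e := j)) = R C1 C2" "e \<notin> R C1 C2"
    using assms unfolding local_rule_def by (metis DiffD2 fun_upd_other insertCI, blast)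
  then show ?thesis by (cases d) (auto simp: switch_config_def fun_eq_iff)
qed

text \<open>The induction step, with the children of a node replaced by arbitrary rules on the other
  edges. In this form it applies to leaves too, whose remaining rule is the empty one.\<close>

lemma harris_query:
  assumes "finite F" "e \<in> F" and R: "\<And>i j. harris_rule (F - {e}) p (R i j)"
  shows "harris_rule F p (\<lambda>C1 C2. decide e d \<union> R (C1 e) (C2 e) C1 C2)"
  unfolding harris_rule_def
proof (intro conjI allI impI)
  have loc: "local_rule (F - {e}) (R i j)" for i j
    using R by (simp add: harris_rule_def)
  then show "local_rule F (\<lambda>C1 C2. decide e d \<union> R (C1 e) (C2 e) C1 C2)"
    by (rule local_query[OF assms(2)])
  fix f g :: "('a \<Rightarrow> bool) \<Rightarrow> real"
  assume f: "mono_on (configs F) f" and g: "mono_on (configs F) g"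
  define q where "q = pmf (bernoulli_pmf (p e))"
  define a where "a i = mean (F - {e}) p (\<lambda>C. f (C(e := i)))" for i
  define b where "b i = mean (F - {e}) p (\<lambda>C. g (C(e := i)))" for i
  define k where "k i j = (if d = Into_S then i else j)" for i j :: bool
  have q: "0 \<le> q i" "q True + q False = 1" for i
    using sum_pmf_eq_1[of UNIV "bernoulli_pmf (p e)"]
    by (simp_all add: q_def) (simp add: UNIV_bool)
  have ab: "a False \<le> a True" "b False \<le> b True"
    unfolding a_def b_def by (rule mean_section_mono[OF assms(1,2)], fact)+
  have "mean F p f * mean F p g = (\<Sum>i\<in>UNIV. q i * a i) * (\<Sum>j\<in>UNIV. q j * b j)"
    unfolding mean_query[OF assms(1,2)] q_def a_def b_def ..
  also have "\<dots> \<le> (\<Sum>i\<in>UNIV. \<Sum>j\<in>UNIV. q i * q j * (a i * b (k i j)))"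
  proof (cases "d = Into_S")
    case True
    \<comment> \<open>The same value \<open>i\<close> enters both factors, so \<open>j\<close> averages out.\<close>
    have "(\<Sum>j\<in>UNIV. q i * q j * (a i * b i)) = (q True + q False) * (q i * (a i * b i))" for i
      by (simp add: UNIV_bool algebra_simps)
    then have "(\<Sum>i\<in>UNIV. \<Sum>j\<in>UNIV. q i * q j * (a i * b (k i j)))
        = (\<Sum>i\<in>UNIV. q i * (a i * b i))"
      using True by (simp only: k_def q(2) if_True mult_1 simp_thms)
    then show ?thesis
      using two_point_Chebyshev[of q a b, OF q ab] by (simp only:)
  next
    case False
    \<comment> \<open>The factors depend on different coordinates, and equality holds.\<close>
    then show ?thesis by (simp add: k_def UNIV_bool algebra_simps)
  qed
  also have "\<dots> \<le> (\<Sum>i\<in>UNIV. \<Sum>j\<in>UNIV. q i * q j * mean (F - {e}) p (\<lambda>C1. mean (F - {e}) p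
      (\<lambda>C2. f (C1(e := i)) * g ((switch_config C1 (R i j C1 C2) C2)(e := k i j)))))"
  proof (intro sum_mono mult_left_mono)
    fix i j
    show "a i * b (k i j) \<le> mean (F - {e}) p (\<lambda>C1. mean (F - {e}) p
        (\<lambda>C2. f (C1(e := i)) * g ((switch_config C1 (R i j C1 C2) C2)(e := k i j))))"
      unfolding a_def b_def
      using assms(2) f g by (intro harris_ruleD[OF R] mono_on_section)
    show "0 \<le> q i * q j" using q(1) by simp
  qed
  also have "\<dots> = mean F p (\<lambda>C1. mean F p (\<lambda>C2.
      f C1 * g (switch_config C1 (decide e d \<union> R (C1 e) (C2 e) C1 C2) C2)))"
    by (subst mean_mean_query[OF assms(1,2)])
      (simp only: q_def k_def fun_upd_same switch_query[OF loc])
  finally show "mean F p f * mean F p g \<le> \<dots>" .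
qed

section \<open>Decision trees\<close>

lemma branches_nonempty: "branches T \<noteq> {}"
  by (induction T) (auto, blast)

text \<open>That \<open>e\<close> lies in \<open>E\<close> is only visible on a branch through the node, so it needs the child trees
  to have branches. Removing \<open>e\<close> from the edge set encodes that no path queries an edge twice.\<close>

lemma decision_tree_Node:
  assumes "decision_tree E (Node e d child)"
  shows "e \<in> E" "decision_tree (E - {e}) (child i j)"
proof -
  show "e \<in> E"
    using assms branches_nonempty[of "child i j"] by (fastforce simp: decision_tree_def)
  show "decision_tree (E - {e}) (child i j)"
    using assms by (fastforce simp: decision_tree_def)
qed

lemma harris_tree:
  "finite F \<Longrightarrow> decision_tree F T \<Longrightarrow> harris_rule F p (built_set T)"
proof (induction T arbitrary: F)
  case (Leaf e d)
  then have "harris_rule F p (\<lambda>C1 C2. decide e d \<union> {})"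
    by (intro harris_query[where R = "\<lambda>_ _ _ _. {}"] harris_empty) (auto simp: decision_tree_def)
  then show ?case by simp
next
  case (Node e d child)
  have "harris_rule F p (\<lambda>C1 C2. decide e d \<union> built_set (child (C1 e) (C2 e)) C1 C2)"
    using decision_tree_Node[OF Node.prems(2)] Node.prems(1)
    by (intro harris_query[where R = "\<lambda>i j. built_set (child i j)"]
        Node.IH[OF rangeI rangeI]) auto
  then show ?case by simp
qed

text \<open>Apply the Harris inequality to the constant functions \<open>1\<close> and \<open>-1\<close>, both increasing; the
  second one reverses the inequality for \<open>g\<close>.\<close>

lemma mean_switch:
  assumes "harris_rule F p S" "mono_on (configs F) g"
  shows "mean F p (\<lambda>C1. mean F p (\<lambda>C2. g (switch_config C1 (S C1 C2) C2))) = mean F p g"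
proof -
  have "mean F p (\<lambda>_. c) * mean F p g
      \<le> mean F p (\<lambda>C1. mean F p (\<lambda>C2. c * g (switch_config C1 (S C1 C2) C2)))" for c
    by (intro harris_ruleD assms mono_onI order_refl)
  from this[of 1] this[of "-1"] show ?thesis by simp
qed

lemma mono_on_indicator:
  "closed_upward E A \<Longrightarrow> mono_on (configs E) (indicat_real A)"
  by (rule mono_onI) (auto simp: closed_upward_def indicator_def le_fun_def)

theorem theorem3p2:
  fixes V :: "'v set" and E :: "'v set set" and p :: "'v set \<Rightarrow> real"
    and T :: "'v set query_tree" and A B :: "('v set \<Rightarrow> bool) set"
    and \<mu> :: "('v set \<Rightarrow> bool) pmf"
    and P :: "(('v set \<Rightarrow> bool) \<times> ('v set \<Rightarrow> bool)) pmf"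
    and S :: "('v set \<Rightarrow> bool) \<Rightarrow> ('v set \<Rightarrow> bool) \<Rightarrow> 'v set set"
  defines "\<mu> \<equiv> percolation E p"
    and "P \<equiv> pair_pmf \<mu> \<mu>"
    and "S \<equiv> built_set T"
  assumes "finite_simple_graph V E" and "connected_graph V E"
    and "\<And>e. e \<in> E \<Longrightarrow> p e \<in> {0..1}"
    and "decision_tree E T"
    and "A \<subseteq> configs E" and "closed_upward E A"
    and "B \<subseteq> configs E" and "closed_upward E B"
  shows "measure_pmf.prob P {(C1, C2). C1 \<in> A \<and> switch_config C1 (S C1 C2) C2 \<in> B}
           \<ge> measure_pmf.prob P {(C1, C2). C1 \<in> A}
             * measure_pmf.prob P {(C1, C2). switch_config C1 (S C1 C2) C2 \<in> B}
       \<and> measure_pmf.prob P {(C1, C2). C1 \<in> A}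
             * measure_pmf.prob P {(C1, C2). switch_config C1 (S C1 C2) C2 \<in> B}
           = measure_pmf.prob \<mu> A * measure_pmf.prob \<mu> B"
proof -
  have fin: "finite E"
  proof (rule finite_subset)
    show "E \<subseteq> Pow V" "finite (Pow V)"
      using \<open>finite_simple_graph V E\<close> by (auto simp: finite_simple_graph_def nsets_def)
  qed
  have rule: "harris_rule E p S"
    unfolding S_def using fin \<open>decision_tree E T\<close> by (rule harris_tree)
  have A: "mono_on (configs E) (indicat_real A)" and B: "mono_on (configs E) (indicat_real B)"
    using assms by (auto intro: mono_on_indicator)
  have P: "measure_pmf.prob P X = mean E p (\<lambda>C1. mean E p (\<lambda>C2. indicat_real X (C1, C2)))" for X
    using expectation_pair_percolation[OF fin, of p "indicat_real X"]
    by (simp add: P_def \<mu>_def)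
  have 1: "measure_pmf.prob P {(C1, C2). C1 \<in> A} = mean E p (indicat_real A)"
  proof -
    have "indicat_real {(C1, C2). C1 \<in> A} (C1, C2) = indicat_real A C1"
      for C1 C2 :: "'v set \<Rightarrow> bool"
      by (simp add: indicator_def)
    then show ?thesis unfolding P by simp
  qed
  have 2: "measure_pmf.prob P {(C1, C2). switch_config C1 (S C1 C2) C2 \<in> B}
      = mean E p (indicat_real B)"
    unfolding P mean_switch[OF rule B, symmetric]
    by (intro Bochner_Integration.integral_cong refl) (simp add: indicator_def)
  have 3: "measure_pmf.prob P {(C1, C2). C1 \<in> A \<and> switch_config C1 (S C1 C2) C2 \<in> B}
      = mean E p (\<lambda>C1. mean E p (\<lambda>C2.
          indicat_real A C1 * indicat_real B (switch_config C1 (S C1 C2) C2)))"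
    unfolding P by (intro Bochner_Integration.integral_cong refl) (simp add: indicator_def)
  have 4: "mean E p (indicat_real A) * mean E p (indicat_real B)
      \<le> mean E p (\<lambda>C1. mean E p (\<lambda>C2.
          indicat_real A C1 * indicat_real B (switch_config C1 (S C1 C2) C2)))"
    by (rule harris_ruleD[OF rule A B])
  show ?thesis
    unfolding 1 2 3 using 4 by (simp add: \<mu>_def)
qed

end
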